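(* The two-sample Kolmogorov--Smirnov test is universally detection coherent. That is, let $\mathcal P$ be the set of all pairs $(F,G)$ of cumulative distribution functions on $\mathbb R$, let $\mathcal H_0=\{(F,G)\in\mathcal P:F=G\}$ and let $\mathcal D_0=\{(F,G)\in\mathcal P:\sup_x|F(x)-G(x)|=0\}$ be the detection-null set of the test. Then $\mathcal S_{\mathcal P}=\mathcal D_0\setminus\mathcal H_0=\emptyset$.
   Context: The Kolmogorov--Smirnov test is calibrated under the null $\mathcal H_0$. Its detector is $\sup_x|\hat F_n(x)-\hat G_n(x)|$ ($\hat F_n,\hat G_n$ the empirical distribution functions). The detector converges in probability to the detection functional $\theta(F,G)=\sup_x|F(x)-G(x)|$, which has the constant value $\theta^*=0$ on $\mathcal H_0$. The detection-null set is $\mathcal D_0=\{\theta=\theta^*\}$ and the blind spot is $\mathcal S_{\mathcal P}=\mathcal D_0\setminus\mathcal H_0$. A test is universally detection coherent if $\mathcal S_{\mathcal P}=\emptyset$. *)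

theory Defs
  imports "HOL-Probability.Probability"
begin

text \<open>
  A testing problem consists of a model \<open>P\<close> and a null hypothesis \<open>H0 \<subseteq> P\<close>. A test enters
  through its detection functional \<open>\<theta>\<close> (the limit in probability of its detector) and the
  constant value \<open>\<theta>\<^sub>0\<close> of \<open>\<theta>\<close> on \<open>H0\<close>.
\<close>

definition detection_null_set :: "'p set \<Rightarrow> ('p \<Rightarrow> real) \<Rightarrow> real \<Rightarrow> 'p set" where
  "detection_null_set P \<theta> \<theta>\<^sub>0 = {p \<in> P. \<theta> p = \<theta>\<^sub>0}"

definition blind_spot :: "'p set \<Rightarrow> 'p set \<Rightarrow> ('p \<Rightarrow> real) \<Rightarrow> real \<Rightarrow> 'p set" where
  "blind_spot P H0 \<theta> \<theta>\<^sub>0 = detection_null_set P \<theta> \<theta>\<^sub>0 - H0"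

definition universally_detection_coherent ::
    "'p set \<Rightarrow> 'p set \<Rightarrow> ('p \<Rightarrow> real) \<Rightarrow> real \<Rightarrow> bool" where
  "universally_detection_coherent P H0 \<theta> \<theta>\<^sub>0 \<longleftrightarrow> blind_spot P H0 \<theta> \<theta>\<^sub>0 = {}"

definition cdfs :: "(real \<Rightarrow> real) set" where
  "cdfs = {cdf M | M. real_distribution M}"

definition ks_model :: "((real \<Rightarrow> real) \<times> (real \<Rightarrow> real)) set" where
  "ks_model = cdfs \<times> cdfs"

definition ks_null :: "((real \<Rightarrow> real) \<times> (real \<Rightarrow> real)) set" where
  "ks_null = {(F, G) \<in> ks_model. F = G}"

text \<open>
  On \<open>ks_model\<close> the supremum is over a nonempty set bounded by 1, so the real-valued \<open>SUP\<close>
  is the genuine supremum there.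
\<close>

definition ks_functional :: "(real \<Rightarrow> real) \<times> (real \<Rightarrow> real) \<Rightarrow> real" where
  "ks_functional = (\<lambda>(F, G). SUP x. \<bar>F x - G x\<bar>)"

end

theory Submission
  imports Defs
begin

text \<open>The functional is a supremum of absolute differences, so it dominates each of them. If
  it vanishes, every difference is zero and the two distribution functions agree pointwise. The
  domination is \<open>abs_diff_le_ks_functional\<close>.\<close>

lemma cdfs_bounds:
  assumes "F \<in> cdfs"
  shows "0 \<le> F x" "F x \<le> 1"
proof -
  obtain M where "real_distribution M" and F: "F = cdf M"
    using assms unfolding cdfs_def by blast
  then interpret real_distribution M by simp
  show "0 \<le> F x" "F x \<le> 1"
    unfolding F by (rule cdf_nonneg, rule cdf_bounded_prob)
qed

text \<open>A real-valued \<open>SUP\<close> is known to bound its family only when that family is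
  bounded above. Here 1 is a bound, since both functions take values in [0, 1] by
  \<open>cdfs_bounds\<close>.\<close>

lemma abs_diff_le_ks_functional:
  assumes "(F, G) \<in> ks_model"
  shows "\<bar>F x - G x\<bar> \<le> ks_functional (F, G)"
proof -
  have "F \<in> cdfs" "G \<in> cdfs"
    using assms by (auto simp: ks_model_def)
  then have "\<bar>F y - G y\<bar> \<le> 1" for y
    using cdfs_bounds[of F y] cdfs_bounds[of G y] by linarith
  then have "bdd_above (range (\<lambda>y. \<bar>F y - G y\<bar>))"
    by (intro bdd_aboveI2)
  then show ?thesis
    unfolding ks_functional_def prod.case by (rule cSUP_upper[OF UNIV_I])
qed

theorem mainTheorem7:
  shows "universally_detection_coherent ks_model ks_null ks_functional 0"
proof -
  have "F = G" if "(F, G) \<in> ks_model" and "ks_functional (F, G) = 0" for F G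
  proof
    fix x
    show "F x = G x"
      \<comment> \<open>The bound becomes \<bar>F x - G x\<bar> \<le> 0.\<close>
      using abs_diff_le_ks_functional[OF that(1), of x] that(2) by simp
  qed
  then show ?thesis
    unfolding universally_detection_coherent_def blind_spot_def detection_null_set_def ks_null_def
    by auto
qed

end
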